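(* Let $\mathcal{A}\in\mathbb{R}^{[m,n]}$ be a nonsingular $M$-tensor and $b\in\mathbb{R}^n$, and suppose that $$\mathcal{S}_l=\{x\in\mathbb{R}^n \mid x\ge 0,\ \mathcal{A}x^{m-1}\le b\}\neq\emptyset.$$ Let $\mathcal{A}=\mathcal{M}-\mathcal{N}$ be the level-1 splitting of $\mathcal{A}$, let $M$ be the majorization matrix of $\mathcal{A}$, and let $M=P-Q$ where $P$ is a nonsingular $M$-matrix and $Q\ge 0$. Then for any $x_0>0$ such that $\mathcal{A}x_0^{m-1}>0$ and $\mathcal{A}x_0^{m-1}\ge b$, the sequence $\{x_k\}$ of nonnegative vectors given by the iteration $$P x_{k+1}^{[m-1]}=Q x_k^{[m-1]}+\mathcal{N}x_k^{m-1}+b,\qquad k\ge 0,$$ is monotonically decreasing (i.e. $x_{k+1}\le x_k$ for all $k$) and converges to the maximal nonnegative solution of $\mathcal{A}x^{m-1}=b$.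
   Context: $\mathbb{R}^{[m,n]}$ ($m\ge 2$, $n\ge 1$) is the set of real $m$th-order $n$-dimensional tensors $\mathcal{A}=(a_{i_1i_2\ldots i_m})$, $1\le i_1,\ldots,i_m\le n$. For $x\in\mathbb{R}^n$, $\mathcal{A}x^{m-1}\in\mathbb{R}^n$ has entries $(\mathcal{A}x^{m-1})_i=\sum_{i_2,\ldots,i_m=1}^n a_{ii_2\ldots i_m}x_{i_2}\cdots x_{i_m}$. Vector inequalities $x\ge y$ and $x>y$, and inequalities for matrices and tensors, are entrywise. For $r>0$, $x^{[r]}$ is the entrywise power, $(x^{[r]})_i=(x_i)^r$. The identity tensor $\mathcal{I}$ has diagonal elements $\mathcal{I}_{ii\ldots i}=1$ and all other elements $0$. A real $\lambda$ is an eigenvalue of $\mathcal{B}$ if $\mathcal{B}x^{m-1}=\lambda x^{[m-1]}$ for some $x\in\mathbb{R}^n\setminus\{0\}$; the spectral radius $\rho(\mathcal{B})$ is the maximum modulus of the eigenvalues. $\mathcal{A}$ is a nonsingular $M$-tensor if $\mathcal{A}=s\mathcal{I}-\mathcal{B}$ with $\mathcal{B}\ge 0$ and $s>\rho(\mathcal{B})$. A maximal nonnegative solution of $\mathcal{A}x^{m-1}=b$ is a nonnegative solution $x$ with $x\ge y$ for every solution $y\ge 0$. Level-1 splitting: $\mathcal{A}=\mathcal{M}-\mathcal{N}$, where $\mathcal{M}=(m_{i_1\ldots i_m})$ has $m_{ij\ldots j}=a_{ij\ldots j}$ for all $i,j\in\{1,\ldots,n\}$ and all other elements zero. The majorization matrix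 of $\mathcal{A}$ is the $n\times n$ matrix $M$ with $(i,j)$ entry $a_{ij\ldots j}$, so $\mathcal{M}x^{m-1}=Mx^{[m-1]}$. A nonsingular $M$-matrix is a matrix of the form $sI-B$ with $B\ge 0$ and $s>\rho(B)$. Explicitly, the iteration is $x_{k+1}=\left(P^{-1}(Qx_k^{[m-1]}+\mathcal{N}x_k^{m-1}+b)\right)^{[1/(m-1)]}$, where the vector being raised to the power $1/(m-1)$ is nonnegative for each $k$ under the hypotheses. *)

theory Defs
  imports "HOL-Analysis.Analysis"
begin

text \<open>
  A tensor of order \<open>m\<close> and dimension \<open>CARD('n)\<close> is a function on index lists over \<open>'n\<close>. Only its
  values at lists of length \<open>m\<close> are entries of the tensor; all notions below take the order \<open>m\<close>
  as an argument and look at no other values.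

  The library order \<open>\<le>\<close> on \<open>real ^ 'n\<close> and \<open>real ^ 'n ^ 'n\<close> is the entrywise one. The library \<open><\<close>
  on these types is not entrywise, so strict inequalities are written out by components.
\<close>

type_synonym 'n tensor = "'n list \<Rightarrow> real"

definition tensor_eq :: "nat \<Rightarrow> 'n tensor \<Rightarrow> 'n tensor \<Rightarrow> bool" where
  "tensor_eq m A B \<longleftrightarrow> (\<forall>is. length is = m \<longrightarrow> A is = B is)"

definition nonneg_tensor :: "nat \<Rightarrow> 'n tensor \<Rightarrow> bool" where
  "nonneg_tensor m A \<longleftrightarrow> (\<forall>is. length is = m \<longrightarrow> 0 \<le> A is)"

definition id_tensor :: "nat \<Rightarrow> 'n tensor" where
  "id_tensor m is = (if \<exists>i. is = replicate m i then 1 else 0)"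

definition tensor_app :: "nat \<Rightarrow> ('n::finite) tensor \<Rightarrow> real ^ 'n \<Rightarrow> real ^ 'n" where
  "tensor_app m A x =
     (\<chi> i. \<Sum>js | length js = m - 1. A (i # js) * (\<Prod>j\<leftarrow>js. x $ j))"

definition vec_pow :: "real ^ 'n \<Rightarrow> nat \<Rightarrow> real ^ ('n::finite)" where
  "vec_pow x r = (\<chi> i. (x $ i) ^ r)"

definition tensor_eigenvalue :: "nat \<Rightarrow> ('n::finite) tensor \<Rightarrow> real \<Rightarrow> bool" where
  "tensor_eigenvalue m B l \<longleftrightarrow>
     (\<exists>x. x \<noteq> 0 \<and> tensor_app m B x = l *\<^sub>R vec_pow x (m - 1))"

text \<open>
  The supremum is the maximum whenever the latter exists, see \<open>tensor_spectral_radius_eq_max\<close>.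
  For a nonnegative tensor it does exist: the eigenvalue set is nonempty (Perron--Frobenius for
  tensors), bounded by the row sums and closed.
\<close>

definition tensor_spectral_radius :: "nat \<Rightarrow> ('n::finite) tensor \<Rightarrow> real" where
  "tensor_spectral_radius m B = Sup {\<bar>l\<bar> | l. tensor_eigenvalue m B l}"

lemma tensor_spectral_radius_eq_max:
  assumes "tensor_eigenvalue m B l" and "\<And>k. tensor_eigenvalue m B k \<Longrightarrow> \<bar>k\<bar> \<le> \<bar>l\<bar>"
  shows "tensor_spectral_radius m B = \<bar>l\<bar>"
  unfolding tensor_spectral_radius_def using assms by (intro cSup_eq_maximum) auto

definition nonsingular_M_tensor :: "nat \<Rightarrow> ('n::finite) tensor \<Rightarrow> bool" where
  "nonsingular_M_tensor m A \<longleftrightarrow>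
     (\<exists>s B. nonneg_tensor m B \<and> tensor_spectral_radius m B < s \<and>
            tensor_eq m A (\<lambda>is. s * id_tensor m is - B is))"

text \<open>
  For matrices, eigenvalues are the usual complex ones. Their set is finite and nonempty, so the
  supremum below is a maximum.
\<close>

definition matrix_eigenvalue :: "real ^ 'n ^ 'n \<Rightarrow> complex \<Rightarrow> bool" where
  "matrix_eigenvalue B c \<longleftrightarrow>
     (\<exists>v :: complex ^ ('n::finite). v \<noteq> 0 \<and> map_matrix complex_of_real B *v v = c *s v)"

definition matrix_spectral_radius :: "real ^ 'n ^ 'n \<Rightarrow> real" where
  "matrix_spectral_radius (B :: real ^ ('n::finite) ^ 'n) = Sup {cmod c | c. matrix_eigenvalue B c}"

lemma matrix_spectral_radius_eq_max:
  assumes "matrix_eigenvalue B c" and "\<And>d. matrix_eigenvalue B d \<Longrightarrow> cmod d \<le> cmod c"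
  shows "matrix_spectral_radius B = cmod c"
  unfolding matrix_spectral_radius_def using assms by (intro cSup_eq_maximum) auto

definition nonsingular_M_matrix :: "real ^ 'n ^ 'n \<Rightarrow> bool" where
  "nonsingular_M_matrix (A :: real ^ ('n::finite) ^ 'n) \<longleftrightarrow>
     (\<exists>s B. 0 \<le> B \<and> matrix_spectral_radius B < s \<and> A = s *\<^sub>R mat 1 - B)"

definition level1_splitting ::
    "nat \<Rightarrow> 'n tensor \<Rightarrow> 'n tensor \<Rightarrow> 'n tensor \<Rightarrow> bool" where
  "level1_splitting m A MT NT \<longleftrightarrow>
     tensor_eq m A (\<lambda>is. MT is - NT is) \<and>
     tensor_eq m MT (\<lambda>is. if \<exists>i j. is = i # replicate (m - 1) j then A is else 0)"

definition majorization_matrix :: "nat \<Rightarrow> ('n::finite) tensor \<Rightarrow> real ^ 'n ^ 'n" where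
  "majorization_matrix m A = (\<chi> i j. A (i # replicate (m - 1) j))"

definition lower_solution_set :: "nat \<Rightarrow> ('n::finite) tensor \<Rightarrow> real ^ 'n \<Rightarrow> (real ^ 'n) set" where
  "lower_solution_set m A b = {x. 0 \<le> x \<and> tensor_app m A x \<le> b}"

definition maximal_nonneg_solution ::
    "nat \<Rightarrow> ('n::finite) tensor \<Rightarrow> real ^ 'n \<Rightarrow> real ^ 'n \<Rightarrow> bool" where
  "maximal_nonneg_solution m A b x \<longleftrightarrow>
     0 \<le> x \<and> tensor_app m A x = b \<and> (\<forall>y. 0 \<le> y \<and> tensor_app m A y = b \<longrightarrow> y \<le> x)"

definition splitting_iteration ::
    "nat \<Rightarrow> real ^ 'n ^ 'n \<Rightarrow> real ^ 'n ^ 'n \<Rightarrow> 'n tensor \<Rightarrow> real ^ 'n \<Rightarrow> real ^ 'n \<Rightarrow>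
     (nat \<Rightarrow> real ^ ('n::finite)) \<Rightarrow> bool" where
  "splitting_iteration m P Q NT b x0 X \<longleftrightarrow>
     X 0 = x0 \<and> (\<forall>k. 0 \<le> X k) \<and>
     (\<forall>k. P *v vec_pow (X (Suc k)) (m - 1)
          = Q *v vec_pow (X k) (m - 1) + tensor_app m NT (X k) + b)"

end

theory Submission
  imports Defs
begin

text \<open>
  Every \<open>z\<close> in the lower solution set lies below \<open>x0\<close>: at an index where the ratio \<open>z $ i / x0 $ i\<close>
  attains a maximum \<open>t > 1\<close>, the sign pattern of \<open>A\<close> would give \<open>(A z)\<^sub>i \<ge> t^(m-1) (A x0)\<^sub>i > (A x0)\<^sub>i\<close>.
  As \<open>P\<close> is inverse-nonnegative and \<open>Q\<close>, \<open>NT\<close> are nonnegative, the iteration map is monotone, so the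
  iterates stay above \<open>z\<close> and decrease; the limit solves the equation and dominates all solutions.
  Inverse-nonnegativity of \<open>s I - B\<close> comes from Brouwer's theorem: if it failed, there would be
  a nonzero \<open>u \<ge> 0\<close> with \<open>B u \<ge> s u\<close>, and a fixed point on the simplex section cut out
  by this inequality would be an eigenvector of \<open>B\<close> for an eigenvalue at least \<open>s\<close>.
\<close>

lemma finite_type_attains_max:
  fixes f :: "'a::finite \<Rightarrow> real"
  obtains i where "\<And>j. f j \<le> f i"
proof -
  have "Max (range f) \<in> range f" by (intro Max_in) auto
  then obtain i where "Max (range f) = f i" by blast
  then show ?thesis using that[of i] Max_ge[of "range f"] by (metis finite_code finite_imageI rangeI)
qed

section \<open>Nonsingular M-matrices are inverse-nonnegative\<close>

lemma matrix_vector_mult_nonneg: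
  fixes B :: "real ^ 'n ^ 'm"
  assumes "0 \<le> B" and "0 \<le> x"
  shows "0 \<le> B *v x"
  using assms
  by (auto simp: less_eq_vec_def matrix_vector_mult_def intro!: sum_nonneg mult_nonneg_nonneg)

lemma matrix_vector_mult_mono:
  fixes B :: "real ^ 'n ^ 'm"
  assumes "0 \<le> B" and "x \<le> y"
  shows "B *v x \<le> B *v y"
  using matrix_vector_mult_nonneg[of B "y - x"] assms
  by (simp add: less_eq_vec_def matrix_vector_mult_diff_distrib)

text \<open>The map \<open>C = B + c I\<close> commutes with \<open>B\<close> and therefore
  preserves the inequality \<open>s x \<le> B x\<close>. Divided by the coordinate sum, it sends the
  compact convex set \<open>K\<close> into itself, and a Brouwer fixed point is an eigenvector of
  \<open>C\<close>, hence of \<open>B\<close>.\<close>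

lemma nonneg_matrix_eigenvalue_ge:
  fixes B :: "real ^ 'n ^ 'n"
  assumes B: "0 \<le> B" and u: "0 \<le> u" "u \<noteq> 0" and le: "s *\<^sub>R u \<le> B *v u"
  obtains t v where "s \<le> t" and "v \<noteq> 0" and "B *v v = t *\<^sub>R v"
proof -
  \<comment> \<open>This shift gives \<open>s + c \<ge> 1\<close> for \<open>s\<close> of either
    sign, so the coordinate sum of \<open>C x\<close> is at least 1 on \<open>K\<close> and
    \<open>f\<close> never divides by zero there.\<close>
  define c where "c = \<bar>s\<bar> + 1"
  define C where "C x = B *v x + c *\<^sub>R x" for x
  define \<sigma> where "\<sigma> x = (\<Sum>i\<in>UNIV. x $ i)" for x :: "real ^ 'n"
  define K where "K = {x. 0 \<le> x \<and> \<sigma> x = 1 \<and> s *\<^sub>R x \<le> B *v x}"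
  define f where "f x = inverse (\<sigma> (C x)) *\<^sub>R C x" for x
  have c: "s + c \<ge> 1" "c \<ge> 0" unfolding c_def by auto
  have lin: "linear \<sigma>"
    unfolding \<sigma>_def by (intro linearI) (auto simp: sum.distrib sum_distrib_left)
  have \<sigma>_mono: "\<sigma> x \<le> \<sigma> y" if "x \<le> y" for x y
    using that unfolding \<sigma>_def less_eq_vec_def by (intro sum_mono) auto
  have \<sigma>_cont: "continuous_on S \<sigma>" for S
    using lin linear_continuous_on linear_linear by blast
  have C_cont: "continuous_on S C" for S
    unfolding C_def by (intro continuous_intros linear_continuous_on) auto
  have C_nonneg: "0 \<le> C x" if "0 \<le> x" for x
    using matrix_vector_mult_nonneg[OF B that] that c
    by (auto simp: C_def less_eq_vec_def)
  have C_sum: "1 \<le> \<sigma> (C x)" if "x \<in> K" for x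
  proof -
    have "(s + c) *\<^sub>R x \<le> C x" using that
      by (auto simp: C_def K_def less_eq_vec_def algebra_simps)
    then have "(s + c) * \<sigma> x \<le> \<sigma> (C x)"
      using \<sigma>_mono lin by (metis linear_scale real_scaleR_def)
    then show ?thesis using that c by (simp add: K_def)
  qed
  have comp: "compact K"
  proof -
    have eq: "K = {x. \<forall>i. 0 \<le> x $ i} \<inter> {x. \<sigma> x = 1} \<inter> {x. \<forall>i. s * x $ i \<le> (B *v x) $ i}"
      by (auto simp: K_def less_eq_vec_def)
    have "closed K" unfolding eq
      by (intro closed_Int closed_Collect_all closed_Collect_le closed_Collect_eq
            continuous_intros \<sigma>_cont linear_continuous_on) auto
    moreover have "K \<subseteq> cbox 0 1"
    proof
      fix x assume x: "x \<in> K"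
      then have "x $ i \<le> \<sigma> x" for i
        unfolding \<sigma>_def by (intro member_le_sum) (auto simp: K_def less_eq_vec_def)
      then show "x \<in> cbox 0 1"
        using x by (auto simp: mem_box_cart K_def less_eq_vec_def)
    qed
    ultimately show ?thesis
      using bounded_cbox bounded_subset compact_eq_bounded_closed by blast
  qed
  have conv: "convex K"
  proof (rule convexI)
    fix x y and p q :: real
    assume xy: "x \<in> K" "y \<in> K" and pq: "0 \<le> p" "0 \<le> q" "p + q = 1"
    have "s *\<^sub>R (p *\<^sub>R x + q *\<^sub>R y) = p *\<^sub>R (s *\<^sub>R x) + q *\<^sub>R (s *\<^sub>R y)"
      by (simp add: algebra_simps)
    also have "\<dots> \<le> p *\<^sub>R (B *v x) + q *\<^sub>R (B *v y)"
      using xy pq unfolding less_eq_vec_def K_def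
      by (auto simp: mult.assoc intro!: add_mono mult_left_mono)
    also have "\<dots> = B *v (p *\<^sub>R x + q *\<^sub>R y)"
      by (simp add: matrix_vector_right_distrib matrix_vector_mult_scaleR)
    finally have "s *\<^sub>R (p *\<^sub>R x + q *\<^sub>R y) \<le> B *v (p *\<^sub>R x + q *\<^sub>R y)" .
    moreover have "0 \<le> p *\<^sub>R x + q *\<^sub>R y" using xy pq by (simp add: K_def less_eq_vec_def)
    moreover have "\<sigma> (p *\<^sub>R x + q *\<^sub>R y) = 1"
      using xy pq lin by (simp add: K_def linear_add linear_scale)
    ultimately show "p *\<^sub>R x + q *\<^sub>R y \<in> K" by (simp only: K_def mem_Collect_eq simp_thms)
  qed
  have ne: "K \<noteq> {}"
  proof -
    obtain i where "u $ i \<noteq> 0" using u(2) by (auto simp: vec_eq_iff)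
    then have pos: "0 < \<sigma> u"
      using u(1) unfolding \<sigma>_def less_eq_vec_def
      by (intro sum_pos2[of _ i]) (auto simp: less_le)
    have "s *\<^sub>R (inverse (\<sigma> u) *\<^sub>R u) = inverse (\<sigma> u) *\<^sub>R (s *\<^sub>R u)" by simp
    also have "\<dots> \<le> inverse (\<sigma> u) *\<^sub>R (B *v u)"
      using le pos by (auto simp: less_eq_vec_def intro!: mult_left_mono)
    finally have "inverse (\<sigma> u) *\<^sub>R u \<in> K"
      using u pos lin by (auto simp: K_def linear_scale less_eq_vec_def matrix_vector_mult_scaleR)
    then show ?thesis by auto
  qed
  have f_cont: "continuous_on K f"
    unfolding f_def using C_sum
    by (intro continuous_intros C_cont continuous_on_compose2[OF \<sigma>_cont[of UNIV] C_cont]) force+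
  have f_K: "f x \<in> K" if x: "x \<in> K" for x
  proof -
    have pos: "0 < \<sigma> (C x)" using C_sum[OF x] by simp
    \<comment> \<open>The residual \<open>B x - s x\<close> is nonnegative on \<open>K\<close>, and
      \<open>C\<close> carries it to the residual of \<open>C x\<close>.\<close>
    have "0 \<le> C (B *v x - s *\<^sub>R x)" using x by (intro C_nonneg) (auto simp: K_def)
    also have "C (B *v x - s *\<^sub>R x) = B *v C x - s *\<^sub>R C x"
      by (simp add: C_def matrix_vector_right_distrib matrix_vector_mult_diff_distrib
          matrix_vector_mult_scaleR algebra_simps)
    finally have "s *\<^sub>R C x \<le> B *v C x" by (simp add: less_eq_vec_def)
    moreover have "0 \<le> C x" using C_nonneg x by (simp add: K_def)
    ultimately show ?thesis using pos lin
      by (auto simp: f_def K_def linear_scale less_eq_vec_def matrix_vector_mult_scaleR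
          mult.left_commute[of s] intro!: mult_left_mono)
  qed
  obtain v where v: "v \<in> K" "f v = v"
    using brouwer[OF comp conv ne f_cont] f_K by blast
  define t where "t = \<sigma> (C v) - c"
  have "C v = \<sigma> (C v) *\<^sub>R f v" using C_sum[OF v(1)] by (simp add: f_def)
  then have eig: "B *v v = t *\<^sub>R v"
    using v(2) by (simp add: C_def t_def algebra_simps)
  \<comment> \<open>Since \<open>\<sigma> v = 1\<close>, summing the coordinates of
    \<open>s v \<le> t v\<close> compares the two scalars.\<close>
  have "\<sigma> (s *\<^sub>R v) \<le> \<sigma> (t *\<^sub>R v)"
    using v(1) eig by (intro \<sigma>_mono) (simp add: K_def)
  then have "s \<le> t" using v(1) lin by (simp add: K_def linear_scale)
  moreover have "v \<noteq> 0" using v(1) lin by (auto simp: K_def linear_0)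
  ultimately show ?thesis using eig that by blast
qed

text \<open>At a coordinate where an eigenvector has largest modulus, the eigenvalue is bounded by
  the absolute row sum. Boundedness is what makes the \<open>Sup\<close> in the spectral radius an
  upper bound.\<close>

lemma bdd_above_matrix_eigenvalues:
  fixes B :: "real ^ 'n ^ 'n"
  shows "bdd_above {cmod c | c. matrix_eigenvalue B c}"
proof -
  define R where "R = (\<Sum>i\<in>UNIV. \<Sum>j\<in>UNIV. \<bar>B $ i $ j\<bar>)"
  have "cmod c \<le> R" if c: "matrix_eigenvalue B c" for c
  proof -
    obtain v :: "complex ^ 'n"
      where v: "v \<noteq> 0" "map_matrix complex_of_real B *v v = c *s v"
      using c unfolding matrix_eigenvalue_def by blast
    obtain i where max: "\<And>j. cmod (v $ j) \<le> cmod (v $ i)"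
      using finite_type_attains_max[of "\<lambda>i. cmod (v $ i)"] by blast
    obtain k where "v $ k \<noteq> 0" using v(1) by (auto simp: vec_eq_iff)
    then have pos: "0 < cmod (v $ i)" using max[of k] by (meson less_le_trans zero_less_norm_iff)
    have "cmod c * cmod (v $ i) = cmod ((map_matrix complex_of_real B *v v) $ i)"
      by (simp add: v(2) norm_mult)
    also have "\<dots> \<le> (\<Sum>j\<in>UNIV. \<bar>B $ i $ j\<bar> * cmod (v $ j))"
      unfolding matrix_vector_mult_def by (simp add: sum_norm_le norm_mult map_matrix_def)
    also have "\<dots> \<le> (\<Sum>j\<in>UNIV. \<bar>B $ i $ j\<bar> * cmod (v $ i))"
      using max by (intro sum_mono mult_left_mono) auto
    also have "\<dots> = (\<Sum>j\<in>UNIV. \<bar>B $ i $ j\<bar>) * cmod (v $ i)" by (simp add: sum_distrib_right)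
    also have "\<dots> \<le> R * cmod (v $ i)"
      unfolding R_def
      by (intro mult_right_mono member_le_sum[where f = "\<lambda>i. \<Sum>j\<in>UNIV. \<bar>B $ i $ j\<bar>"])
         (auto intro: sum_nonneg)
    finally show ?thesis using pos by simp
  qed
  then show ?thesis by (auto intro!: bdd_aboveI)
qed

text \<open>Complexifying the eigenvector links the real eigenvalue found by Brouwer's theorem to
  the spectral radius, which ranges over complex eigenvalues.\<close>

lemma real_eigenvalue_le_spectral_radius:
  fixes B :: "real ^ 'n ^ 'n"
  assumes "v \<noteq> 0" and "B *v v = t *\<^sub>R v"
  shows "\<bar>t\<bar> \<le> matrix_spectral_radius B"
proof -
  define w :: "complex ^ 'n" where "w = (\<chi> i. complex_of_real (v $ i))"
  have "map_matrix complex_of_real B *v w = complex_of_real t *s w"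
  proof (rule vec_eq_iff[THEN iffD2], rule allI)
    fix i
    have "(map_matrix complex_of_real B *v w) $ i = complex_of_real ((B *v v) $ i)"
      by (simp add: matrix_vector_mult_def w_def map_matrix_def)
    then show "(map_matrix complex_of_real B *v w) $ i = (complex_of_real t *s w) $ i"
      by (simp add: assms(2) w_def)
  qed
  moreover have "w \<noteq> 0" using assms(1) by (auto simp: w_def vec_eq_iff)
  ultimately have "matrix_eigenvalue B (complex_of_real t)"
    unfolding matrix_eigenvalue_def by blast
  then show ?thesis
    unfolding matrix_spectral_radius_def
    by (intro cSup_upper bdd_above_matrix_eigenvalues) (auto intro!: exI[of _ "complex_of_real t"])
qed

lemma nonsingular_M_matrix_nonneg:
  fixes P :: "real ^ 'n ^ 'n"
  assumes P: "nonsingular_M_matrix P" and w: "0 \<le> P *v w"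
  shows "0 \<le> w"
proof (rule ccontr)
  assume neg: "\<not> 0 \<le> w"
  obtain s B where B: "0 \<le> B" "matrix_spectral_radius B < s" "P = s *\<^sub>R mat 1 - B"
    using P unfolding nonsingular_M_matrix_def by auto
  \<comment> \<open>The negative part of \<open>w\<close>; it is nonzero exactly when
    \<open>w\<close> has a negative entry.\<close>
  define u where "u = (\<chi> i. max 0 (- (w $ i)))"
  have u0: "0 \<le> u" by (simp add: u_def less_eq_vec_def)
  obtain k where "w $ k < 0" using neg by (auto simp: less_eq_vec_def not_le)
  then have "u $ k \<noteq> 0" by (simp add: u_def)
  then have "u \<noteq> 0" by auto
  moreover have "s *\<^sub>R u \<le> B *v u"
    unfolding less_eq_vec_def
  proof
    fix i
    have Pw: "P *v w = s *\<^sub>R w - B *v w"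
      by (simp add: B(3) matrix_vector_mult_diff_rdistrib scaleR_matrix_vector_assoc[symmetric])
    \<comment> \<open>From \<open>- u \<le> w\<close> follows
      \<open>- B u \<le> B w \<le> s w\<close>. Where \<open>w $ i < 0\<close>, substituting
      \<open>w $ i = - u $ i\<close> gives the claim; elsewhere \<open>u $ i = 0\<close> and
      \<open>B u \<ge> 0\<close> is enough.\<close>
    have "B *v (- u) \<le> B *v w"
      by (rule matrix_vector_mult_mono[OF B(1)]) (auto simp: u_def less_eq_vec_def)
    then have "- (B *v u) $ i \<le> (B *v w) $ i"
      by (auto simp: less_eq_vec_def matrix_vector_mult_def sum_negf)
    moreover have "(B *v w) $ i \<le> s * w $ i"
      using w Pw by (auto simp: less_eq_vec_def)
    moreover have "0 \<le> (B *v u) $ i"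
      using matrix_vector_mult_nonneg[OF B(1) u0] by (auto simp: less_eq_vec_def)
    ultimately show "(s *\<^sub>R u) $ i \<le> (B *v u) $ i"
      by (cases "w $ i < 0") (auto simp: u_def)
  qed
  ultimately obtain t v where "s \<le> t" "v \<noteq> 0" "B *v v = t *\<^sub>R v"
    using nonneg_matrix_eigenvalue_ge[OF B(1) u0] by metis
  with real_eigenvalue_le_spectral_radius B(2) show False by fastforce
qed

lemma nonsingular_M_matrix_le:
  fixes P :: "real ^ 'n ^ 'n"
  assumes "nonsingular_M_matrix P" and "P *v x \<le> P *v y"
  shows "x \<le> y"
  using nonsingular_M_matrix_nonneg[of P "y - x"] assms
  by (simp add: less_eq_vec_def matrix_vector_mult_diff_distrib)

text \<open>Equal images compare in both directions, so \<open>P\<close> is injective, and in finite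
  dimension also surjective.\<close>

lemma nonsingular_M_matrix_surj:
  fixes P :: "real ^ 'n ^ 'n"
  assumes "nonsingular_M_matrix P"
  shows "surj ((*v) P)"
proof (rule linear_inj_imp_surj)
  show "inj ((*v) P)"
    using nonsingular_M_matrix_le[OF assms] by (intro injI) (simp add: order_antisym)
qed simp

section \<open>Entrywise powers and tensors\<close>

lemma vec_pow_mono:
  assumes "0 \<le> x" and "x \<le> y"
  shows "vec_pow x r \<le> vec_pow y r"
  using assms by (auto simp: vec_pow_def less_eq_vec_def intro!: power_mono)

lemma vec_pow_le_imp_le:
  assumes "vec_pow x r \<le> vec_pow y r" and "0 \<le> y" and "0 < r"
  shows "x \<le> y"
  using assms
  by (cases r) (auto simp: vec_pow_def less_eq_vec_def simp del: power_Suc intro: power_le_imp_le_base)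

text \<open>The entrywise root plays the part of the exponent \<open>1/(m-1)\<close> in the explicit
  iteration.\<close>

lemma vec_pow_surj_nonneg:
  assumes "0 \<le> w" and "0 < r"
  obtains y where "0 \<le> y" and "vec_pow y r = w"
proof
  show "0 \<le> (\<chi> i. root r (w $ i))" "vec_pow (\<chi> i. root r (w $ i)) r = w"
    using assms by (auto simp: vec_pow_def less_eq_vec_def vec_eq_iff)
qed

lemma prod_list_nonneg:
  fixes x :: "real ^ 'n"
  assumes "0 \<le> x"
  shows "0 \<le> (\<Prod>j\<leftarrow>js. x $ j)"
  using assms by (induction js) (auto simp: less_eq_vec_def)

lemma prod_list_mono:
  fixes x y :: "real ^ 'n"
  assumes "0 \<le> x" and "x \<le> y"
  shows "(\<Prod>j\<leftarrow>js. x $ j) \<le> (\<Prod>j\<leftarrow>js. y $ j)"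
proof (induction js)
  case (Cons j js)
  then show ?case
    using assms prod_list_nonneg[of x js]
    by (auto simp: less_eq_vec_def intro!: mult_mono order_trans[of 0 "x $ j" "y $ j"])
qed simp

lemma finite_lists_length: "finite {js :: ('n::finite) list. length js = r}"
  using finite_lists_length_eq[of "UNIV :: 'n set" r] by simp

lemma tensor_app_mono:
  assumes "nonneg_tensor m A" and "1 \<le> m" and "0 \<le> x" and "x \<le> y"
  shows "tensor_app m A x \<le> tensor_app m A y"
  using assms prod_list_mono[OF assms(3,4)]
  by (auto simp: tensor_app_def less_eq_vec_def nonneg_tensor_def intro!: sum_mono mult_left_mono)

lemma tensor_app_scaleR:
  "tensor_app m A (t *\<^sub>R x) = t ^ (m - 1) *\<^sub>R tensor_app m A x"
proof -
  have "(\<Prod>j\<leftarrow>js. (t *\<^sub>R x) $ j) = t ^ length js * (\<Prod>j\<leftarrow>js. x $ j)" for js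
    by (induction js) auto
  then show ?thesis
    by (auto simp: tensor_app_def vec_eq_iff sum_distrib_left intro!: sum.cong)
qed

lemma tendsto_tensor_app:
  assumes "(X \<longlongrightarrow> x) F"
  shows "((\<lambda>k. tensor_app m A (X k)) \<longlongrightarrow> tensor_app m A x) F"
proof -
  have "((\<lambda>k. \<Prod>j\<leftarrow>js. X k $ j) \<longlongrightarrow> (\<Prod>j\<leftarrow>js. x $ j)) F" for js
    by (induction js) (auto intro!: tendsto_intros assms)
  then show ?thesis
    unfolding tensor_app_def by (intro tendsto_intros tendsto_vec_lambda)
qed

lemma tendsto_vec_pow:
  assumes "(X \<longlongrightarrow> x) F"
  shows "((\<lambda>k. vec_pow (X k) r) \<longlongrightarrow> vec_pow x r) F"
  unfolding vec_pow_def by (intro tendsto_vec_lambda tendsto_intros assms)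

section \<open>Sign pattern of M-tensors and a comparison principle\<close>

lemma nonsingular_M_tensor_offdiag:
  assumes "nonsingular_M_tensor m A" and "length is = m" and "\<nexists>i. is = replicate m i"
  shows "A is \<le> 0"
  using assms by (auto simp: nonsingular_M_tensor_def tensor_eq_def nonneg_tensor_def id_tensor_def)

text \<open>In row \<open>i\<close> the diagonal term is the same for \<open>x\<close> and
  \<open>y\<close>. Every other entry is nonpositive, while its monomial grows from \<open>x\<close>
  to \<open>y\<close>.\<close>

lemma tensor_app_touching:
  fixes A :: "('n::finite) tensor"
  assumes A: "nonsingular_M_tensor m A" and m: "1 \<le> m"
    and xy: "0 \<le> x" "x \<le> y" "x $ i = y $ i"
  shows "tensor_app m A y $ i \<le> tensor_app m A x $ i"
  unfolding tensor_app_def vec_lambda_beta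
proof (rule sum_mono)
  fix js :: "'n list" assume "js \<in> {js. length js = m - 1}"
  then have len: "length js = m - 1" by simp
  show "A (i # js) * (\<Prod>j\<leftarrow>js. y $ j) \<le> A (i # js) * (\<Prod>j\<leftarrow>js. x $ j)"
  proof (cases "js = replicate (m - 1) i")
    case True
    then show ?thesis using xy(3) by (simp add: map_replicate)
  next
    case False
    then have "\<nexists>k. i # js = replicate m k" using m by (cases m) auto
    then have "A (i # js) \<le> 0"
      using len m by (intro nonsingular_M_tensor_offdiag[OF A]) auto
    then show ?thesis using prod_list_mono[OF xy(1,2)] by (simp add: mult_left_mono_neg)
  qed
qed

lemma tensor_app_comparison:
  assumes A: "nonsingular_M_tensor m A" and m: "2 \<le> m"
    and z: "0 \<le> z" and x: "\<forall>i. 0 < x $ i" "\<forall>i. 0 < tensor_app m A x $ i"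
    and le: "tensor_app m A z \<le> tensor_app m A x"
  shows "z \<le> x"
proof (rule ccontr)
  assume "\<not> z \<le> x"
  then obtain k where k: "x $ k < z $ k" by (auto simp: less_eq_vec_def not_le)
  obtain i where i: "\<And>j. z $ j / x $ j \<le> z $ i / x $ i"
    using finite_type_attains_max[of "\<lambda>i. z $ i / x $ i"] by blast
  define t where "t = z $ i / x $ i"
  have max: "z $ j / x $ j \<le> t" for j
    unfolding t_def by (rule i)
  have "1 < z $ k / x $ k" using k x by simp
  then have t: "1 < t" using max[of k] by linarith
  \<comment> \<open>The multiple \<open>t x\<close> dominates \<open>z\<close> and touches it at
    \<open>i\<close>. Homogeneity of degree \<open>m - 1\<close> then contradicts
    \<open>t > 1\<close>, because \<open>(A x)\<close> is positive at \<open>i\<close>.\<close>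
  have "tensor_app m A (t *\<^sub>R x) $ i \<le> tensor_app m A z $ i"
  proof (rule tensor_app_touching[OF A _ z])
    show "z \<le> t *\<^sub>R x" using max x(1) by (simp add: less_eq_vec_def divide_le_eq)
    show "z $ i = (t *\<^sub>R x) $ i" using x(1) by (simp add: t_def less_imp_neq[symmetric])
  qed (use m in simp)
  also have "\<dots> \<le> tensor_app m A x $ i" using le by (simp add: less_eq_vec_def)
  finally have "t ^ (m - 1) * tensor_app m A x $ i \<le> 1 * tensor_app m A x $ i"
    by (simp add: tensor_app_scaleR)
  then have "t ^ (m - 1) \<le> 1" using x(2) by (simp only: mult_le_cancel_right_pos)
  moreover have "1 < t ^ (m - 1)" using t m by (intro one_less_power) auto
  ultimately show False by simp
qed

section \<open>The level-1 splitting\<close>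

text \<open>At the positions kept by \<open>MT\<close> the entry of \<open>NT\<close> is 0. At all
  others it is the negated entry of \<open>A\<close>, and these positions are off the
  diagonal.\<close>

lemma level1_splitting_nonneg:
  assumes A: "nonsingular_M_tensor m A" and split: "level1_splitting m A MT NT" and m: "1 \<le> m"
  shows "nonneg_tensor m NT"
  unfolding nonneg_tensor_def
proof (intro allI impI)
  fix js :: "'a list" assume len: "length js = m"
  have 1: "A js = MT js - NT js"
    and 2: "MT js = (if \<exists>i j. js = i # replicate (m - 1) j then A js else 0)"
    using split len unfolding level1_splitting_def tensor_eq_def by blast+
  show "0 \<le> NT js"
  proof (cases "\<exists>i j. js = i # replicate (m - 1) j")
    case True
    then show ?thesis using 1 2 by simp
  next
    case False
    have "replicate m k = k # replicate (m - 1) k" for k :: 'a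
      using m by (cases m) auto
    then have "A js \<le> 0"
      using False by (intro nonsingular_M_tensor_offdiag[OF A len]) metis
    then show ?thesis using 1 2 False by simp
  qed
qed

text \<open>The monomials at the positions kept by \<open>MT\<close> are pure powers
  \<open>(x $ j) ^ (m - 1)\<close>, so the contribution of \<open>MT\<close> is the majorization
  matrix applied to \<open>vec_pow x (m - 1)\<close>.\<close>

lemma level1_splitting_app:
  assumes split: "level1_splitting m A MT NT" and m: "2 \<le> m"
  shows "tensor_app m A x = majorization_matrix m A *v vec_pow x (m - 1) - tensor_app m NT x"
proof (rule vec_eq_iff[THEN iffD2], rule allI)
  fix i
  let ?L = "{js :: 'a list. length js = m - 1}"
  let ?p = "\<lambda>js. \<Prod>j\<leftarrow>js. x $ j"
  let ?D = "range (replicate (m - 1)) :: 'a list set"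
  have A: "A (i # js) = MT (i # js) - NT (i # js)"
    and MT: "MT (i # js) = (if js \<in> ?D then A (i # js) else 0)" if "js \<in> ?L" for js
  proof -
    have len: "length (i # js) = m" using that m by simp
    then show "A (i # js) = MT (i # js) - NT (i # js)"
      using split unfolding level1_splitting_def tensor_eq_def by blast
    have "MT (i # js) = (if \<exists>k j. i # js = k # replicate (m - 1) j then A (i # js) else 0)"
      using split len unfolding level1_splitting_def tensor_eq_def by blast
    then show "MT (i # js) = (if js \<in> ?D then A (i # js) else 0)"
      by (simp only: list.inject image_iff bex_UNIV) simp
  qed
  \<comment> \<open>Here \<open>m - 1 > 0\<close> matters: for length 0 all indices \<open>j\<close>
    would give the same empty list.\<close>
  have inj: "inj_on (replicate (m - 1)) (UNIV :: 'a set)"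
    using m by (auto simp: inj_on_def)
  have "tensor_app m A x $ i + tensor_app m NT x $ i = (\<Sum>js\<in>?L. MT (i # js) * ?p js)"
    by (auto simp: tensor_app_def sum.distrib[symmetric] A algebra_simps intro!: sum.cong)
  also have "\<dots> = (\<Sum>js\<in>?D. A (i # js) * ?p js)"
  proof (rule sum.mono_neutral_cong_right)
    show sub: "?D \<subseteq> ?L" by auto
    show "MT (i # js) * ?p js = A (i # js) * ?p js" if "js \<in> ?D" for js
      using MT[OF subsetD[OF sub that]] by (simp only: that if_True)
  qed (simp_all add: MT finite_lists_length)
  also have "\<dots> = (\<Sum>j\<in>UNIV. A (i # replicate (m - 1) j) * (x $ j) ^ (m - 1))"
    by (subst sum.reindex[OF inj]) (simp add: map_replicate prod_list_replicate)
  also have "\<dots> = (majorization_matrix m A *v vec_pow x (m - 1)) $ i"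
    by (simp add: majorization_matrix_def vec_pow_def matrix_vector_mult_def)
  finally show "tensor_app m A x $ i
      = (majorization_matrix m A *v vec_pow x (m - 1) - tensor_app m NT x) $ i"
    by simp
qed

section \<open>Monotone convergence of the iteration\<close>

lemma decseq_vec_convergent:
  fixes X :: "nat \<Rightarrow> real ^ 'n"
  assumes "\<And>k. X (Suc k) \<le> X k" and "\<And>k. l \<le> X k"
  obtains x where "X \<longlonglongrightarrow> x"
proof -
  have "\<exists>a. (\<lambda>k. X k $ i) \<longlonglongrightarrow> a" for i
  proof -
    have "decseq (\<lambda>k. X k $ i)"
      using assms(1) by (intro decseq_SucI) (simp add: less_eq_vec_def)
    then show ?thesis
      using assms(2) by (elim decseq_convergent[where B = "l $ i"]) (auto simp: less_eq_vec_def)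
  qed
  then obtain a where "\<And>i. (\<lambda>k. X k $ i) \<longlonglongrightarrow> a i" by metis
  then have "X \<longlonglongrightarrow> (\<chi> i. a i)" by (intro vec_tendstoI) auto
  then show ?thesis using that by blast
qed

text \<open>The iteration is encoded as a relation on nonnegative sequences. Unique existence is
  proved along with the convergence claim, which could otherwise hold vacuously.\<close>

theorem theorem12:
  fixes m :: nat
    and A MT NT :: "('n::finite) tensor"
    and M P Q :: "real ^ 'n ^ 'n"
    and b x0 :: "real ^ 'n"
  assumes "2 \<le> m"
    and "nonsingular_M_tensor m A"
    and "lower_solution_set m A b \<noteq> {}"
    and "level1_splitting m A MT NT"
    and "M = majorization_matrix m A"
    and "M = P - Q" and "nonsingular_M_matrix P" and "0 \<le> Q"
    and "\<forall>i. 0 < x0 $ i"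
    and "\<forall>i. 0 < tensor_app m A x0 $ i"
    and "b \<le> tensor_app m A x0"
  shows "(\<exists>!X. splitting_iteration m P Q NT b x0 X) \<and>
         (\<forall>X. splitting_iteration m P Q NT b x0 X \<longrightarrow>
            (\<forall>k. X (Suc k) \<le> X k) \<and>
            (\<exists>x. maximal_nonneg_solution m A b x \<and> X \<longlonglongrightarrow> x))"
proof -
  note m = \<open>2 \<le> m\<close>
  then have r: "0 < m - 1" by simp
  let ?p = "\<lambda>x :: real ^ 'n. vec_pow x (m - 1)"
  define S where "S = lower_solution_set m A b"
  \<comment> \<open>The right-hand side of the iteration. Since
    \<open>A x - b = P (?p x) - R x\<close>, the inequalities \<open>A x \<le> b\<close> and
    \<open>A x \<ge> b\<close> and the equation \<open>A x = b\<close> become comparisons of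
    \<open>P (?p x)\<close> with \<open>R x\<close>.\<close>
  define R where "R x = Q *v ?p x + tensor_app m NT x + b" for x
  note P_le = nonsingular_M_matrix_le[OF \<open>nonsingular_M_matrix P\<close>]
  have NT: "nonneg_tensor m NT"
    using level1_splitting_nonneg assms m by fastforce
  have A_app: "tensor_app m A x = P *v ?p x - Q *v ?p x - tensor_app m NT x" for x
    using level1_splitting_app[OF assms(4) m] assms(5,6)
    by (metis matrix_vector_mult_diff_rdistrib)
  have R_mono: "R x \<le> R y" if "0 \<le> x" "x \<le> y" for x y
    using matrix_vector_mult_mono[OF \<open>0 \<le> Q\<close> vec_pow_mono[OF that]] tensor_app_mono[OF NT _ that] m
    unfolding R_def by (auto simp: less_eq_vec_def intro!: add_mono)
  have P_S: "P *v ?p z \<le> R z" if "z \<in> S" for z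
    using that A_app[of z] unfolding R_def S_def lower_solution_set_def
    by (auto simp: less_eq_vec_def algebra_simps)
  have S_nonneg: "0 \<le> z" if "z \<in> S" for z
    using that by (simp add: S_def lower_solution_set_def)
  obtain z where z: "z \<in> S" using assms(3) by (auto simp: S_def)
  have S_le_x0: "y \<le> x0" if "y \<in> S" for y
    by (rule tensor_app_comparison[OF assms(2) m _ assms(9,10)])
       (use that assms(11) in \<open>auto simp: S_def lower_solution_set_def less_eq_vec_def
          intro: order_trans\<close>)
  have x0: "0 \<le> x0" using assms(9) by (auto simp: less_eq_vec_def less_imp_le)

  have p_le: "x \<le> y" if "P *v ?p x \<le> P *v ?p y" "0 \<le> y" for x y
    using vec_pow_le_imp_le[OF P_le[OF that(1)] that(2) r] .
  have step: "\<exists>y. 0 \<le> y \<and> P *v ?p y = R x \<and> z \<le> y" if x: "z \<le> x" for x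
  proof -
    obtain w where w: "P *v w = R x"
      using nonsingular_M_matrix_surj[OF assms(7)] by (metis surjD)
    \<comment> \<open>The lower solution \<open>z\<close> is a barrier: it forces
      \<open>w \<ge> ?p z \<ge> 0\<close>, so the root of \<open>w\<close> can be taken, and the new
      iterate lies above \<open>z\<close> again.\<close>
    have "P *v ?p z \<le> P *v w"
      unfolding w using P_S[OF z] R_mono[OF S_nonneg[OF z] x] by (rule order_trans)
    then have "?p z \<le> w" by (rule P_le)
    moreover have "0 \<le> ?p z" using S_nonneg[OF z] by (auto simp: vec_pow_def less_eq_vec_def)
    ultimately obtain y where y: "0 \<le> y" "?p y = w"
      using vec_pow_surj_nonneg[OF _ r, of w] order_trans by blast
    then have "z \<le> y"
      using p_le \<open>P *v ?p z \<le> P *v w\<close> by blast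
    then show ?thesis using y w by auto
  qed
  have iter: "splitting_iteration m P Q NT b x0 X \<longleftrightarrow>
      X 0 = x0 \<and> (\<forall>k. 0 \<le> X k) \<and> (\<forall>k. P *v ?p (X (Suc k)) = R (X k))" for X
    by (simp add: splitting_iteration_def R_def)

  have "\<exists>!X. splitting_iteration m P Q NT b x0 X"
  proof (rule ex_ex1I)
    \<comment> \<open>The bound \<open>z \<le> X k\<close> is carried along because
      \<open>step\<close> needs it to continue; the implication for \<open>k = 0\<close> fixes the
      start.\<close>
    have "\<exists>X. \<forall>k. (0 \<le> X k \<and> z \<le> X k \<and> (k = 0 \<longrightarrow> X k = x0)) \<and> P *v ?p (X (Suc k)) = R (X k)"
      using step x0 S_le_x0[OF z] by (intro dependent_nat_choice) auto
    then show "\<exists>X. splitting_iteration m P Q NT b x0 X" unfolding iter by metis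
  next
    fix X Y
    assume X: "splitting_iteration m P Q NT b x0 X" and Y: "splitting_iteration m P Q NT b x0 Y"
    have "X k = Y k" for k
    proof (induction k)
      case (Suc k)
      then have "P *v ?p (X (Suc k)) = P *v ?p (Y (Suc k))" using X Y by (simp add: iter)
      moreover have "0 \<le> X (Suc k)" "0 \<le> Y (Suc k)" using X Y by (simp_all add: iter)
      ultimately show ?case using p_le order_antisym order_refl by metis
    qed (use X Y in \<open>simp add: iter\<close>)
    then show "X = Y" by blast
  qed
  moreover have "(\<forall>k. X (Suc k) \<le> X k) \<and> (\<exists>x. maximal_nonneg_solution m A b x \<and> X \<longlonglongrightarrow> x)"
    if "splitting_iteration m P Q NT b x0 X" for X
  proof -
    have X0: "X 0 = x0" and X_nonneg: "\<And>k. 0 \<le> X k"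
      and X_Suc: "\<And>k. P *v ?p (X (Suc k)) = R (X k)"
      using that by (auto simp: iter)
    have dec: "X (Suc k) \<le> X k" for k
    proof (induction k)
      case 0
      \<comment> \<open>This is \<open>b \<le> A x0\<close> rewritten, and it makes the first step
        go down; monotonicity of \<open>R\<close> propagates the descent.\<close>
      have "R x0 \<le> P *v ?p x0"
        using assms(11) A_app[of x0] by (auto simp: R_def less_eq_vec_def algebra_simps)
      then show ?case by (metis X0 X_Suc X_nonneg p_le)
    next
      case (Suc k)
      then have "R (X (Suc k)) \<le> R (X k)" by (intro R_mono X_nonneg)
      then show ?case by (metis X_Suc X_nonneg p_le)
    qed
    \<comment> \<open>Proved for all of \<open>S\<close>, not only for \<open>z\<close>: every
      nonnegative solution belongs to \<open>S\<close>, which yields maximality of the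
      limit.\<close>
    have S_le: "y \<le> X k" if y: "y \<in> S" for y k
    proof (induction k)
      case 0
      then show ?case using S_le_x0[OF y] X0 by simp
    next
      case (Suc k)
      have "P *v ?p y \<le> P *v ?p (X (Suc k))"
        unfolding X_Suc using P_S[OF y] R_mono[OF S_nonneg[OF y] Suc] by (rule order_trans)
      then show ?case using X_nonneg by (rule p_le)
    qed
    obtain x where lim: "X \<longlonglongrightarrow> x" using decseq_vec_convergent[of X 0, OF dec X_nonneg] .
    have lim_le: "y \<le> x" if "\<And>k. y \<le> X k" for y
      unfolding less_eq_vec_def
      using that by (intro allI LIMSEQ_le_const[OF tendsto_vec_nth[OF lim]]) (auto simp: less_eq_vec_def)
    have "(\<lambda>k. R (X k)) \<longlonglongrightarrow> R x"
      unfolding R_def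
      by (intro tendsto_intros tendsto_tensor_app tendsto_vec_pow lim
          bounded_linear.tendsto[OF matrix_vector_mul_bounded_linear])
    moreover have "(\<lambda>k. P *v ?p (X (Suc k))) \<longlonglongrightarrow> P *v ?p x"
      by (intro bounded_linear.tendsto[OF matrix_vector_mul_bounded_linear] tendsto_vec_pow
          LIMSEQ_Suc lim)
    \<comment> \<open>Both sides of the iteration are continuous, so the limit satisfies its
      fixed-point equation, which is \<open>A x = b\<close>.\<close>
    ultimately have "P *v ?p x = R x" unfolding X_Suc using LIMSEQ_unique by blast
    then have "tensor_app m A x = b" using A_app[of x] by (simp add: R_def)
    moreover have "y \<le> x" if "0 \<le> y" "tensor_app m A y = b" for y
      using that by (intro lim_le S_le) (simp add: S_def lower_solution_set_def)
    ultimately have "maximal_nonneg_solution m A b x"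
      unfolding maximal_nonneg_solution_def using lim_le[of 0, OF X_nonneg] by blast
    then show ?thesis using dec lim by blast
  qed
  ultimately show ?thesis by blast
qed

end
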